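(* In the setting of the context (general state space $\mathcal I$, scores $\widehat Q_x$ with uniform error $\varepsilon\ge0$, target distributions $p_x^w$, kernels $P_x$, satisfying the Lipschitz-score, Lipschitz-kernel and uniform-mixing conditions with constants $L_Q'$, $L_P$, $\bar\eta$), consider random incumbents $X_n$ in $\mathcal X$ and states $I_n\in\mathcal I$ generated in the order $$X_0,I_0\ \to\ I_1\ \to\ X_1\ \to\ I_2\ \to\ X_2\ \to\cdots$$ with natural filtration $\{\mathcal F_n\}$ generated by $(I_m,X_m)_{m\le n}$. Conditional on $\mathcal F_n$, the next state $I_{n+1}$ is sampled from $I_n$ through the one-step Markov kernel $P_{X_n}$, which admits the invariant distribution $p^w_{X_n}$ on $\mathcal I$. Fix $p>0$ and $\widetilde\Delta>2\varepsilon$, and suppose that $\|X_n-X_{n-1}\|\le c\,\alpha_n$ almost surely, where $\{\alpha_n\}$ satisfies $\alpha_n\le C_\alpha n^{-p}$ for some $C_\alpha>0$. Then, for every sufficiently large $n$ such that $f(n):=\lceil(p+1)\log n/|\log\bar\eta|\rceil<n/2$ and $2^pcC_\alpha f(n)n^{-p}\le(\widetilde\Delta-2\varepsilon)/(4L_Q')$, it holds that $$\mathbb P\big(I_n\notin I_{\widetilde\Delta}(X_{n-1})\big)\le\bar\eta^{f(n)}+\frac{2^pcL_PC_\alpha}{1-\bar\eta}f(n)n^{-p}+\sup_{x\in\mathcal X}\left\{\frac{\nu\big(\widehat I_{(\widetilde\Delta-2\varepsilon)/2}(x)^c\big)}{\nu\big(\widehat I_{(\widetilde\Delta-2\varepsilon)/4}(x)\big)}\right\}\cdot\exp\left\{-\frac{\widetilde\Delta-2\varepsilon}{4w}\right\}.$$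 In particular, the first two terms on the right-hand side scale in order $O\big((L_P/(1-\bar\eta))\,n^{-p}\log n\big)$.
   Context: $(\mathcal X,\|\cdot\|)$ is a metric space of decisions, $\mathcal X\subseteq\mathbb R^{d_x}$, equipped with a $\sigma$-algebra $\mathcal B_{\mathcal X}$. $Q(x,\xi)$ is the optimal value of the recourse problem $\min_y\{b^\top y:Gy+Ex+U\xi-h\in\mathcal K\}$ ($\mathcal K$ a convex cone), for $x\in\mathcal X$, $\xi\in\Xi$. $\mathcal I$ is a measurable state space equipped with its Borel $\sigma$-algebra $\mathcal B(\mathcal I)$, and $I\mapsto\xi_I\in\Xi$ is measurable with $\sup_{I\in\mathcal I}Q(x,\xi_I)=\sup_{\xi\in\Xi}Q(x,\xi)$ for all $x\in\mathcal X$. For each $x$, the score $\widehat Q_x:\mathcal I\to\mathbb R$ is measurable, with $\sup_{I\in\mathcal I}|Q(x,\xi_I)-\widehat Q_x(I)|\le\varepsilon$ for all $x\in\mathcal X$. $\nu$ is a finite reference measure on $\mathcal I$ with full support, $w>0$, and $p_x^w$ is the probability measure (well defined when $\widehat Q_x$ is bounded) with $$\frac{dp_x^w}{d\nu}(I)=\frac{\exp(\widehat Q_x(I)/w)}{\int_{\mathcal I}\exp(\widehat Q_x(J)/w)\,d\nu(J)}.$$ For each $x$, $P_x$ is a Markov kernel on $\mathcal I$ with invariant distribution $p_x^w$. Total variation: $\|P-P'\|_{\mathrm{TV}}=\sup_{B\in\mathcal B(\mathcal I)}|P(B)-P'(B)|$. Assumptions: (Lipschitz score) there is $L_Q'<\infty$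 with $|\widehat Q_x(i)-\widehat Q_{x'}(i)|\le L_Q'\|x-x'\|$ for all $i\in\mathcal I$, $x,x'\in\mathcal X$; (Lipschitz kernel) there is $L_P$ with $\sup_{I\in\mathcal I}\|P_x(I,\cdot)-P_y(I,\cdot)\|_{\mathrm{TV}}\le L_P\|x-y\|$ for all $x,y\in\mathcal X$; (uniform mixing) there is $\bar\eta\in[0,1)$ with $\sup_{I,J\in\mathcal I}\|P_x(I,\cdot)-P_x(J,\cdot)\|_{\mathrm{TV}}\le\bar\eta$ for all $x\in\mathcal X$. Adversarial sets: with $Q^\star(x):=\sup_{I\in\mathcal I}Q(x,\xi_I)$ and $\widehat Q^\star(x):=\sup_{I\in\mathcal I}\widehat Q_x(I)$, for $\delta\ge0$ set $I_\delta(x):=\{I\in\mathcal I:Q(x,\xi_I)\ge Q^\star(x)-\delta\}$ and $\widehat I_\delta(x):=\{I\in\mathcal I:\widehat Q_x(I)\ge\widehat Q^\star(x)-\delta\}$; $^c$ denotes complement in $\mathcal I$.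
   Formalization: The final O(·) claim is stated for fixed parameters with L_P > 0, since for L_P = 0 its right side is zero while the first term is not; for η̄ = 0, where log η̄ is undefined, f(n) is taken to be 1; the σ-algebra on the decision space is assumed to contain the Borel sets. *)

theory Defs
  imports "HOL-Probability.Probability" "HOL-Library.Landau_Symbols"
begin

text \<open>
  Optimal value of the conic recourse problem, extended real: \<open>\<infinity>\<close> if infeasible,
  \<open>-\<infinity>\<close> if unbounded below.
\<close>
definition recourse_value ::
  "real^'y \<Rightarrow> real^'y^'m \<Rightarrow> real^'x^'m \<Rightarrow> real^'z^'m \<Rightarrow> real^'m \<Rightarrow> (real^'m) set
    \<Rightarrow> real^'x \<Rightarrow> real^'z \<Rightarrow> ereal"
  where "recourse_value b G E U h K x \<xi> =
    (INF y\<in>{y. G *v y + E *v x + U *v \<xi> - h \<in> K}. ereal (b \<bullet> y))"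

definition is_norm :: "('a::real_vector \<Rightarrow> real) \<Rightarrow> bool"
  where "is_norm N \<longleftrightarrow>
    (\<forall>x. 0 \<le> N x) \<and> (\<forall>x. N x = 0 \<longleftrightarrow> x = 0) \<and>
    (\<forall>r x. N (r *\<^sub>R x) = \<bar>r\<bar> * N x) \<and> (\<forall>x y. N (x + y) \<le> N x + N y)"

definition full_support :: "'i::topological_space measure \<Rightarrow> bool"
  where "full_support \<nu> \<longleftrightarrow> (\<forall>S. open S \<and> S \<noteq> {} \<longrightarrow> 0 < emeasure \<nu> S)"

definition gibbs :: "'i measure \<Rightarrow> real \<Rightarrow> ('i \<Rightarrow> real) \<Rightarrow> 'i measure"
  where "gibbs \<nu> w q =
    density \<nu> (\<lambda>I. ennreal (exp (q I / w) / (\<integral>J. exp (q J / w) \<partial>\<nu>)))"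

text \<open>
  Only used for probability measures on a common \<open>\<sigma>\<close>-algebra, where the real supremum
  ranges over a nonempty set bounded by 1.
\<close>
definition tv_dist :: "'i measure \<Rightarrow> 'i measure \<Rightarrow> real"
  where "tv_dist P P' = (SUP B\<in>sets P. \<bar>measure P B - measure P' B\<bar>)"

text \<open>
  The \<open>\<delta>\<close>-optimal states of \<open>q\<close>. Applied to \<open>\<lambda>I. Q x (\<xi> I)\<close> this is the adversarial set
  \<open>I_\<delta>(x)\<close>, applied to the score it is its approximation. The supremum is taken in the
  extended reals, so no boundedness is presupposed.
\<close>
definition near_max :: "('i \<Rightarrow> ereal) \<Rightarrow> real \<Rightarrow> 'i set"
  where "near_max q \<delta> = {I. q I \<ge> (SUP J. q J) - ereal \<delta>}"

definition natural_filtration ::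
  "'w measure \<Rightarrow> 's measure \<Rightarrow> (nat \<Rightarrow> 'w \<Rightarrow> 's) \<Rightarrow> nat \<Rightarrow> 'w measure"
  where "natural_filtration M S Z n =
    sigma (space M) (\<Union>m\<le>n. {Z m -` B \<inter> space M |B. B \<in> sets S})"

text \<open>
  For \<open>\<eta> = 0\<close> the quotient involves \<open>ln 0\<close>. The value 1 is the one the formula takes, for
  given \<open>n \<ge> 2\<close>, at all sufficiently small \<open>\<eta> > 0\<close>.
\<close>
definition mixing_lag :: "real \<Rightarrow> real \<Rightarrow> nat \<Rightarrow> nat"
  where "mixing_lag p \<eta> n =
    (if \<eta> = 0 then 1 else nat \<lceil>(p + 1) * ln (real n) / \<bar>ln \<eta>\<bar>\<rceil>)"

text \<open>
  In a probability bound, \<^const>\<open>outer_measure_of\<close> coincides with the probability whenever the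
  event is measurable (lemma \<open>outer_measure_of_eq\<close>). It is used for events built from
  \<^const>\<open>recourse_value\<close>, which need not be Borel measurable: there \<^const>\<open>emeasure\<close> could
  degenerate to 0.
\<close>

end

theory Submission
  imports Defs
begin

text \<open>
  Let \<open>k\<close> be the mixing lag and \<open>m = n - k > n/2\<close>. The incumbents \<open>X\<^sub>m, \<dots>, X\<^bsub>n-1\<^esub>\<close> differ by at most
  \<open>(k - 1) t\<close> with \<open>t = 2\<^sup>p c C\<^sub>\<alpha> n\<^sup>-\<^sup>p\<close>, so the last \<open>k\<close> transitions almost follow one frozen kernel,
  whose contraction yields the distance \<open>\<eta>\<^sup>k + L\<^sub>P (k - 1) t / (1 - \<eta>)\<close> from its Gibbs measure;
  the Gibbs measure in turn gives small mass to the states far below the maximum of the score.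

  Freezing at the random \<open>X\<^sub>m\<close> would need measurability of \<open>P x\<close> jointly with \<open>x\<close>. Instead
  the decision set is cut into countably many Borel cells of diameter \<open>\<rho>\<close>, one conditions on the
  cell of \<open>X\<^sub>m\<close>, freezes at a representative of the cell, and finally lets \<open>\<rho>\<close> tend to 0. Having
  \<open>k - 1\<close> rather than \<open>k\<close> increments leaves the room in the condition on \<open>n\<close> that absorbs \<open>\<rho>\<close> in
  the comparison of the scores.
\<close>

section \<open>Norms and small cells in Euclidean space\<close>

text \<open>Expansion in the standard basis gives the constant. This direction of the equivalence of
  norms lets Euclidean balls, which are Borel, serve as small sets for \<open>N\<close>.\<close>

lemma is_norm_le_norm:
  fixes N :: "'a::euclidean_space \<Rightarrow> real"
  assumes "is_norm N"
  obtains C where "0 < C" "\<And>x. N x \<le> C * norm x"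
proof -
  have sub: "N (x + y) \<le> N x + N y" and hom: "N (r *\<^sub>R x) = \<bar>r\<bar> * N x"
    and pos: "0 \<le> N x" and zero: "N 0 = 0" for x y r
    using assms by (auto simp: is_norm_def)
  have sum_le: "N (\<Sum>b\<in>F. f b) \<le> (\<Sum>b\<in>F. N (f b))" if "finite F" for F :: "'a set" and f
    using that by induction (auto simp: zero intro: order_trans[OF sub])
  define C where "C = (\<Sum>b\<in>Basis. N b) + 1"
  have C: "0 < C" unfolding C_def by (intro add_nonneg_pos sum_nonneg pos) auto
  have "N x \<le> C * norm x" for x
  proof -
    have "N x = N (\<Sum>b\<in>Basis. (x \<bullet> b) *\<^sub>R b)" by (simp add: euclidean_representation)
    also have "\<dots> \<le> (\<Sum>b\<in>Basis. \<bar>x \<bullet> b\<bar> * N b)"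
      using sum_le[of Basis "\<lambda>b. (x \<bullet> b) *\<^sub>R b"] by (simp add: hom)
    also have "\<dots> \<le> (\<Sum>b\<in>Basis. norm x * N b)"
      by (intro sum_mono mult_right_mono Basis_le_norm pos)
    also have "\<dots> \<le> C * norm x"
      by (simp add: C_def sum_distrib_left algebra_simps)
    finally show ?thesis .
  qed
  with C that show thesis by blast
qed

text \<open>A countable dense subset of \<open>S\<close> itself supplies the centres, so they are
  admissible decisions; the balls around them are then made disjoint. Afterwards \<open>y j\<close>
  need not lie in \<open>C j\<close>, and cells may be empty.\<close>

lemma countable_partition_small_cells:
  fixes S :: "'a::euclidean_space set" and N :: "'a \<Rightarrow> real"
  assumes N: "is_norm N" and S: "S \<noteq> {}" and \<rho>: "0 < \<rho>"
  obtains C :: "nat \<Rightarrow> 'a set" and y where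
    "disjoint_family C" "(\<Union>j. C j) = S" "\<And>j. C j \<in> sets (restrict_space borel S)"
    "\<And>j. y j \<in> S" "\<And>j x. x \<in> C j \<Longrightarrow> N (x - y j) \<le> \<rho>"
proof -
  obtain c where c: "0 < c" "\<And>x. N x \<le> c * norm x" using is_norm_le_norm[OF N] by blast
  obtain T where T: "countable T" "T \<subseteq> S" "S \<subseteq> closure T" using separable[of S] by blast
  have "T \<noteq> {}" using T S by auto
  define y where "y = from_nat_into T"
  have y: "y j \<in> S" for j using T \<open>T \<noteq> {}\<close> by (auto simp: y_def intro: from_nat_into)
  define D where "D j = S \<inter> ball (y j) (\<rho> / c)" for j
  have "S \<subseteq> (\<Union>j. D j)"
  proof
    fix x assume "x \<in> S"
    then have "x \<in> closure T" using T by blast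
    then obtain t where t: "t \<in> T" "dist t x < \<rho> / c"
      using \<rho> c(1) unfolding closure_approachable using divide_pos_pos[of \<rho> c] by blast
    then show "x \<in> (\<Union>j. D j)"
      using \<open>x \<in> S\<close> from_nat_into_to_nat_on[OF T(1) t(1)] by (auto simp: D_def y_def intro!: exI[of _ "to_nat_on T t"])
  qed
  moreover have "N (x - y j) \<le> \<rho>" if "x \<in> D j" for x j
  proof -
    have "norm (x - y j) \<le> \<rho> / c" using that by (auto simp: D_def dist_norm norm_minus_commute)
    then have "c * norm (x - y j) \<le> \<rho>" using c(1) by (simp add: field_simps)
    then show ?thesis using c(2)[of "x - y j"] by simp
  qed
  moreover have "D j \<in> sets (restrict_space borel S)" for j
    by (auto simp: D_def sets_restrict_space)
  ultimately have cover: "S \<subseteq> (\<Union>j. D j)" and small: "\<And>j x. x \<in> D j \<Longrightarrow> N (x - y j) \<le> \<rho>"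
    and meas: "range D \<subseteq> sets (restrict_space borel S)" by auto
  show thesis
  proof (rule that[of "disjointed D" y])
    show "disjoint_family (disjointed D)" by (rule disjoint_family_disjointed)
    show "(\<Union>j. disjointed D j) = S" using cover by (auto simp: UN_disjointed_eq D_def)
    show "disjointed D j \<in> sets (restrict_space borel S)" for j
      using sets.range_disjointed_sets[OF meas] by blast
    show "y j \<in> S" for j by (rule y)
    show "N (x - y j) \<le> \<rho>" if "x \<in> disjointed D j" for j x
      using small that disjointed_subset[of D j] by blast
  qed
qed

section \<open>Contraction of a mixing kernel under perturbation\<close>

text \<open>
  Layer-cake: both integrals are averages over \<open>t \<in> [0, \<eta>)\<close> of the measures of \<open>{t < f - inf f}\<close>.
\<close>
lemma integral_le_if_measure_le:
  fixes f :: "'a \<Rightarrow> real"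
  assumes \<mu>: "prob_space \<mu>" and \<pi>: "prob_space \<pi>" and sets: "sets \<mu> = sets \<pi>"
    and le: "\<And>B. B \<in> sets \<pi> \<Longrightarrow> measure \<mu> B \<le> measure \<pi> B + s"
    and f[measurable]: "f \<in> borel_measurable \<pi>"
    and osc: "\<And>x y. x \<in> space \<pi> \<Longrightarrow> y \<in> space \<pi> \<Longrightarrow> f x - f y \<le> \<eta>"
    and bdd: "\<And>x. x \<in> space \<pi> \<Longrightarrow> b \<le> f x"
  shows "(\<integral>x. f x \<partial>\<mu>) \<le> (\<integral>x. f x \<partial>\<pi>) + \<eta> * s"
proof -
  interpret \<mu>: prob_space \<mu> by fact
  interpret \<pi>: prob_space \<pi> by fact
  note [measurable_cong] = sets
  have sp: "space \<mu> = space \<pi>" using sets by (rule sets_eq_imp_space_eq)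
  have s: "0 \<le> s" using le[of "{}"] by simp
  obtain x0 where x0: "x0 \<in> space \<pi>" using \<pi>.not_empty by blast
  have \<eta>: "0 \<le> \<eta>" using osc[OF x0 x0] by simp
  \<comment> \<open>Subtracting the infimum leaves values in \<open>[0, \<eta>]\<close>, so no level
    beyond \<eta> matters, whatever the size of \<open>f\<close>.\<close>
  define a where "a = (INF x\<in>space \<pi>. f x)"
  have a_le: "a \<le> f x" if "x \<in> space \<pi>" for x
    unfolding a_def using that bdd by (intro cINF_lower bdd_belowI2) auto
  have le_a: "f x \<le> a + \<eta>" if "x \<in> space \<pi>" for x
  proof -
    have "f x - \<eta> \<le> a" unfolding a_def using osc[OF that] x0 by (intro cINF_greatest) (auto simp: algebra_simps)
    then show ?thesis by simp
  qed
  have layer: "(\<integral>\<^sup>+x. ennreal (f x - a) \<partial>\<kappa>) =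
      (\<integral>\<^sup>+t. ennreal (measure \<kappa> {x\<in>space \<pi>. t < f x - a}) * indicator {0..<\<eta>} t \<partial>lborel)"
    if \<kappa>: "prob_space \<kappa>" and s\<kappa>: "sets \<kappa> = sets \<pi>" for \<kappa>
  proof -
    interpret \<kappa>: prob_space \<kappa> by fact
    interpret pair_sigma_finite \<kappa> lborel by unfold_locales
    note [measurable_cong] = s\<kappa>
    have sp\<kappa>: "space \<kappa> = space \<pi>" using s\<kappa> by (rule sets_eq_imp_space_eq)
    have "(\<integral>\<^sup>+x. ennreal (f x - a) \<partial>\<kappa>) =
        (\<integral>\<^sup>+x. (\<integral>\<^sup>+t. indicator {x\<in>space \<pi>. t < f x - a} x * indicator {0..<\<eta>} t \<partial>lborel) \<partial>\<kappa>)"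
    proof (rule nn_integral_cong)
      fix x assume "x \<in> space \<kappa>"
      then have x: "x \<in> space \<pi>" by (simp add: sp\<kappa>)
      have "(\<integral>\<^sup>+t. indicator {x\<in>space \<pi>. t < f x - a} x * indicator {0..<\<eta>} t \<partial>lborel)
         = (\<integral>\<^sup>+t. indicator {0..<f x - a} t \<partial>lborel)"
        using x le_a[OF x] by (intro nn_integral_cong) (auto split: split_indicator)
      then show "ennreal (f x - a) = (\<integral>\<^sup>+t. indicator {x\<in>space \<pi>. t < f x - a} x * indicator {0..<\<eta>} t \<partial>lborel)"
        using a_le[OF x] by simp
    qed
    also have "\<dots> = (\<integral>\<^sup>+t. (\<integral>\<^sup>+x. indicator {x\<in>space \<pi>. t < f x - a} x * indicator {0..<\<eta>} t \<partial>\<kappa>) \<partial>lborel)"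
      by (intro Fubini'[symmetric]) (simp add: indicator_def[of "{x \<in> space \<pi>. _ x}"])
    also have "\<dots> = (\<integral>\<^sup>+t. ennreal (measure \<kappa> {x\<in>space \<pi>. t < f x - a}) * indicator {0..<\<eta>} t \<partial>lborel)"
      by (intro nn_integral_cong) (simp add: nn_integral_multc \<kappa>.emeasure_eq_measure)
    finally show ?thesis .
  qed
  \<comment> \<open>At each level the excess of \<open>\<mu>\<close> over \<open>\<pi>\<close> is at
    most \<open>s\<close>, and the levels fill an interval of length \<eta>. The resulting factor
    \<eta> is the contraction.\<close>
  have "(\<integral>\<^sup>+x. ennreal (f x - a) \<partial>\<mu>) \<le>
      (\<integral>\<^sup>+t. (ennreal (measure \<pi> {x\<in>space \<pi>. t < f x - a}) + ennreal s) * indicator {0..<\<eta>} t \<partial>lborel)"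
    unfolding layer[OF \<mu> sets]
    by (intro nn_integral_mono mult_right_mono) (auto simp flip: ennreal_plus intro!: ennreal_leI le simp: s)
  also have "\<dots> = (\<integral>\<^sup>+x. ennreal (f x - a) \<partial>\<pi>) + ennreal s * ennreal \<eta>"
    unfolding layer[OF \<pi> refl] distrib_right
    by (subst nn_integral_add) (auto simp: nn_integral_cmult \<eta> s)
  finally have nn: "(\<integral>\<^sup>+x. ennreal (f x - a) \<partial>\<mu>) \<le> (\<integral>\<^sup>+x. ennreal (f x - a) \<partial>\<pi>) + ennreal s * ennreal \<eta>" .
  have int: "integrable \<kappa> f" if "prob_space \<kappa>" "sets \<kappa> = sets \<pi>" for \<kappa>
  proof -
    interpret \<kappa>: prob_space \<kappa> by fact
    note [measurable_cong] = that(2)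
    show ?thesis
      using le_a a_le sets_eq_imp_space_eq[OF that(2)]
      by (intro \<kappa>.integrable_const_bound[of _ "\<bar>a\<bar> + \<eta>"]) (fastforce intro!: AE_I2)+
  qed
  have nn_eq: "(\<integral>\<^sup>+x. ennreal (f x - a) \<partial>\<kappa>) = ennreal (\<integral>x. f x - a \<partial>\<kappa>)" "0 \<le> (\<integral>x. f x - a \<partial>\<kappa>)"
    if "prob_space \<kappa>" "sets \<kappa> = sets \<pi>" for \<kappa>
  proof -
    interpret \<kappa>: prob_space \<kappa> by fact
    have ae: "AE x in \<kappa>. 0 \<le> f x - a" using a_le sets_eq_imp_space_eq[OF that(2)] by auto
    then show "(\<integral>\<^sup>+x. ennreal (f x - a) \<partial>\<kappa>) = ennreal (\<integral>x. f x - a \<partial>\<kappa>)"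
      using int[OF that] by (intro nn_integral_eq_integral) auto
    show "0 \<le> (\<integral>x. f x - a \<partial>\<kappa>)" using ae by (rule integral_nonneg_AE)
  qed
  have "(\<integral>x. f x - a \<partial>\<mu>) \<le> (\<integral>x. f x - a \<partial>\<pi>) + s * \<eta>"
  proof -
    have "ennreal (\<integral>x. f x - a \<partial>\<mu>) \<le> ennreal ((\<integral>x. f x - a \<partial>\<pi>) + s * \<eta>)"
      using nn unfolding nn_eq(1)[OF \<mu> sets] nn_eq(1)[OF \<pi> refl]
      by (subst ennreal_plus) (use s \<eta> nn_eq(2)[OF \<pi> refl] in \<open>simp_all only: ennreal_mult mult_nonneg_nonneg\<close>)
    then show ?thesis
      by (subst (asm) ennreal_le_iff) (use s \<eta> nn_eq(2)[OF \<pi> refl] in \<open>intro add_nonneg_nonneg mult_nonneg_nonneg\<close>)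
  qed
  then show ?thesis
    using int[OF \<mu> sets] int[OF \<pi> refl] by (simp add: \<mu>.prob_space \<pi>.prob_space mult.commute)
qed

text \<open>The error \<open>e j = \<eta> ^ j + d / (1 - \<eta>)\<close> solves
  \<open>e (Suc j) = \<eta> * e j + d\<close>: a step of the kernel contracts the previous error by
  \<eta>, and the perturbation adds \<open>d\<close>. One-sided bounds are enough because they are
  carried along for all sets at once.\<close>

lemma perturbed_chain_law_bound:
  fixes \<mu> :: "nat \<Rightarrow> 'a measure"
  assumes \<mu>: "\<And>j. j \<le> k \<Longrightarrow> prob_space (\<mu> j)" "\<And>j. j \<le> k \<Longrightarrow> sets (\<mu> j) = sets \<pi>"
    and \<pi>: "prob_space \<pi>" and R: "R \<in> \<pi> \<rightarrow>\<^sub>M prob_algebra \<pi>" and inv: "Giry_Monad.bind \<pi> R = \<pi>"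
    and mixing: "\<And>x y B. x \<in> space \<pi> \<Longrightarrow> y \<in> space \<pi> \<Longrightarrow> B \<in> sets \<pi> \<Longrightarrow>
      measure (R x) B - measure (R y) B \<le> \<eta>"
    and \<eta>: "0 \<le> \<eta>" "\<eta> < 1" and d: "0 \<le> d"
    and step: "\<And>j B. j < k \<Longrightarrow> B \<in> sets \<pi> \<Longrightarrow>
      measure (\<mu> (Suc j)) B \<le> (\<integral>x. measure (R x) B \<partial>\<mu> j) + d"
    and B: "B \<in> sets \<pi>"
  shows "measure (\<mu> k) B \<le> measure \<pi> B + (\<eta> ^ k + d / (1 - \<eta>))"
proof -
  interpret \<pi>: prob_space \<pi> by fact
  have R'[measurable]: "R \<in> \<pi> \<rightarrow>\<^sub>M subprob_algebra \<pi>" using R by (rule measurable_prob_algebraD)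
  have "j \<le> k \<Longrightarrow> B \<in> sets \<pi> \<Longrightarrow> measure (\<mu> j) B \<le> measure \<pi> B + (\<eta> ^ j + d / (1 - \<eta>))" for j B
  proof (induction j arbitrary: B)
    case 0
    interpret prob_space "\<mu> 0" using \<mu> by simp
    have "0 \<le> measure \<pi> B + d / (1 - \<eta>)" using d \<eta> by (intro add_nonneg_nonneg) auto
    \<comment> \<open>The summand \<open>\<eta> ^ 0 = 1\<close> alone dominates a probability, also
      for \<eta> = 0.\<close>
    then show ?case using prob_le_1[of B] unfolding power_0 by linarith
  next
    case (Suc j)
    have "measure (\<mu> (Suc j)) B \<le> (\<integral>x. measure (R x) B \<partial>\<mu> j) + d" using Suc by (intro step) auto
    \<comment> \<open>Mixing says that the integrand oscillates by at most \<eta>.\<close>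
    also have "(\<integral>x. measure (R x) B \<partial>\<mu> j) \<le> (\<integral>x. measure (R x) B \<partial>\<pi>) + \<eta> * (\<eta> ^ j + d / (1 - \<eta>))"
      using Suc by (intro integral_le_if_measure_le[where b = 0] \<mu> \<pi> mixing Suc.IH) auto
    also have "(\<integral>x. measure (R x) B \<partial>\<pi>) = measure \<pi> B"
      using \<pi>.measure_bind[OF R' Suc.prems(2)] inv by simp
    finally show ?case using \<eta> by (simp add: field_simps)
  qed
  then show ?thesis using B by simp
qed

section \<open>Near-maximal states\<close>

text \<open>This removes the supremum; if \<open>q\<close> is unbounded above, both sides are
  false.\<close>

lemma near_max_ereal_iff: "I \<in> near_max (\<lambda>J. ereal (q J)) d \<longleftrightarrow> (\<forall>J. q J \<le> q I + d)"
proof -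
  have "I \<in> near_max (\<lambda>J. ereal (q J)) d \<longleftrightarrow> (SUP J. ereal (q J)) \<le> ereal (q I + d)"
    by (simp add: near_max_def ereal_minus_le_iff add.commute)
  then show ?thesis by (simp add: SUP_le_iff)
qed

text \<open>The value at \<open>I\<close> and that of a competitor each move by at most
  \<open>t\<close>, hence the loss \<open>2 * t\<close>. \<open>q'\<close> is extended real since it
  also stands for the recourse value; the hypothesis makes it finite.\<close>

lemma near_max_perturb:
  assumes "\<And>i. \<bar>q' i - ereal (q i)\<bar> \<le> ereal t"
  shows "near_max (\<lambda>i. ereal (q i)) d \<subseteq> near_max q' (d + 2 * t)"
proof -
  have fin: "\<bar>q' i\<bar> \<noteq> \<infinity>" for i using assms[of i] by (cases "q' i") auto
  define r where "r i = real_of_ereal (q' i)" for i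
  have q': "q' = (\<lambda>i. ereal (r i))" using fin by (simp add: fun_eq_iff r_def ereal_real')
  have *: "\<bar>r i - q i\<bar> \<le> t" for i using assms[of i] by (simp add: q')
  show ?thesis
  proof
    fix I assume "I \<in> near_max (\<lambda>i. ereal (q i)) d"
    then have "q J \<le> q I + d" for J by (simp add: near_max_ereal_iff)
    then have "r J \<le> r I + (d + 2 * t)" for J
      using *[of I] *[of J] by (smt (verit))
    then show "I \<in> near_max q' (d + 2 * t)" by (simp add: q' near_max_ereal_iff)
  qed
qed

lemma sets_near_max:
  assumes [measurable]: "q \<in> borel_measurable M" and "space M = UNIV"
  shows "near_max (\<lambda>i. ereal (q i)) d \<in> sets M"
proof -
  have "near_max (\<lambda>i. ereal (q i)) d = {i\<in>space M. (SUP J. ereal (q J)) - ereal d \<le> ereal (q i)}"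
    using assms(2) by (auto simp: near_max_def)
  also have "\<dots> \<in> sets M" by measurable
  finally show ?thesis .
qed

section \<open>Concentration of Gibbs measures\<close>

lemma gibbs_normalizer_pos:
  assumes int: "integrable \<nu> (\<lambda>I. exp (q I / w))" and "emeasure \<nu> (space \<nu>) \<noteq> 0"
  shows "0 < (\<integral>J. exp (q J / w :: real) \<partial>\<nu>)"
proof -
  have "\<not> (AE x in \<nu>. False)" using assms(2) AE_iff_null[of \<nu> "\<lambda>_. False"] by (simp add: null_sets_def)
  then have "(\<integral>J. exp (q J / w) \<partial>\<nu>) \<noteq> 0"
    using integral_nonneg_eq_0_iff_AE[OF int] by auto
  moreover have "0 \<le> (\<integral>J. exp (q J / w) \<partial>\<nu>)" by simp
  ultimately show ?thesis by linarith
qed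

lemma prob_space_gibbs:
  assumes int: "integrable \<nu> (\<lambda>I. exp (q I / w))" and ne: "emeasure \<nu> (space \<nu>) \<noteq> 0"
  shows "prob_space (gibbs \<nu> w q)"
proof
  define Z where "Z = (\<integral>J. exp (q J / w) \<partial>\<nu>)"
  have Z: "0 < Z" unfolding Z_def by (rule gibbs_normalizer_pos[OF assms])
  have int': "integrable \<nu> (\<lambda>I. exp (q I / w) / Z)" using int by simp
  have "emeasure (gibbs \<nu> w q) (space \<nu>) = (\<integral>\<^sup>+I. ennreal (exp (q I / w) / Z) \<partial>\<nu>)"
    unfolding gibbs_def Z_def[symmetric] using int'
    by (subst emeasure_density) (auto intro!: nn_integral_cong dest: borel_measurable_integrable)
  also have "\<dots> = ennreal (\<integral>I. exp (q I / w) / Z \<partial>\<nu>)"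
    using Z int' by (intro nn_integral_eq_integral) auto
  also have "\<dots> = 1" using Z by (simp add: Z_def)
  finally show "emeasure (gibbs \<nu> w q) (space (gibbs \<nu> w q)) = 1" by (simp add: gibbs_def)
qed

text \<open>
  If \<open>q\<close> is unbounded above, both sets \<open>near_max\<close> are empty and the right-hand side is \<open>\<infinity>\<close>.
\<close>
lemma gibbs_compl_near_max_le:
  assumes q[measurable]: "q \<in> borel_measurable \<nu>" and fin: "finite_measure \<nu>" and sp: "space \<nu> = UNIV"
    and int: "integrable \<nu> (\<lambda>I. exp (q I / w))" and ne: "emeasure \<nu> UNIV \<noteq> 0" and w: "0 < w"
  shows "emeasure (gibbs \<nu> w q) (- near_max (\<lambda>i. ereal (q i)) (\<delta> / 2))
    \<le> emeasure \<nu> (- near_max (\<lambda>i. ereal (q i)) (\<delta> / 2)) / emeasure \<nu> (near_max (\<lambda>i. ereal (q i)) (\<delta> / 4))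
      * ennreal (exp (- (\<delta> / (4 * w))))"
proof -
  define A where "A = - near_max (\<lambda>i. ereal (q i)) (\<delta> / 2)"
  define B where "B = near_max (\<lambda>i. ereal (q i)) (\<delta> / 4)"
  define Z where "Z = (\<integral>J. exp (q J / w) \<partial>\<nu>)"
  define e where "e = exp (- (\<delta> / (4 * w)))"
  interpret finite_measure \<nu> by fact
  have Z: "0 < Z" unfolding Z_def using gibbs_normalizer_pos[OF int] ne sp by simp
  have [measurable]: "B \<in> sets \<nu>" by (simp add: B_def sets_near_max sp)
  have [measurable]: "A \<in> sets \<nu>"
    using sets.compl_sets[OF sets_near_max[OF q sp, of "\<delta> / 2"]] by (simp add: A_def sp Compl_eq_Diff_UNIV)
  have g: "emeasure (gibbs \<nu> w q) A = (\<integral>\<^sup>+I. ennreal (exp (q I / w) / Z) * indicator A I \<partial>\<nu>)"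
    unfolding gibbs_def Z_def[symmetric] by (subst emeasure_density) auto
  have e: "0 < e" by (simp add: e_def)
  have "emeasure (gibbs \<nu> w q) A \<le> emeasure \<nu> A / emeasure \<nu> B * ennreal e"
  \<comment> \<open>In \<open>ennreal\<close> a quotient by 0 is \<infinity> unless the numerator is
    0. In that exceptional case the quotient is 0, but \<open>A\<close> is then a null set of
    \<open>\<nu>\<close>, and the Gibbs measure, having a density, gives it no mass.\<close>
  proof (cases "emeasure \<nu> B = 0")
    case True
    show ?thesis
    proof (cases "emeasure \<nu> A = 0")
      case True
      then have "AE I in \<nu>. I \<notin> A" by (intro AE_not_in) auto
      then have "emeasure (gibbs \<nu> w q) A = 0" unfolding g
        by (subst nn_integral_0_iff_AE) auto
      then show ?thesis by simp
    next
      case False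
      then show ?thesis using True e by (simp add: ennreal_divide_zero ennreal_top_mult)
    qed
  next
    case False
    then have \<beta>: "0 < measure \<nu> B" by (simp add: emeasure_eq_measure zero_less_measure_iff)
    \<comment> \<open>A state of \<open>A\<close> scores at least \<open>\<delta> / 4\<close> below
      every state of \<open>B\<close>. Integrating the resulting inequality over \<open>B\<close>
      and enlarging the domain on the right to the whole space produces the normalizer
      \<open>Z\<close>.\<close>
    have *: "exp (q i / w) / Z \<le> e / measure \<nu> B" if "i \<in> A" for i
    proof -
      have le: "exp (q i / w) \<le> e * exp (q J / w)" if J: "J \<in> B" for J
      proof -
        from \<open>i \<in> A\<close> obtain J' where "q i + \<delta> / 2 < q J'" by (auto simp: A_def near_max_ereal_iff not_le)
        moreover have "q J' \<le> q J + \<delta> / 4" using J by (auto simp: B_def near_max_ereal_iff)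
        ultimately have "q i \<le> q J - \<delta> / 4" by linarith
        then have "q i / w \<le> - (\<delta> / (4 * w)) + q J / w" using w by (simp add: field_simps)
        then show ?thesis by (simp add: e_def flip: exp_add)
      qed
      have "exp (q i / w) * measure \<nu> B = (\<integral>J. exp (q i / w) * indicator B J \<partial>\<nu>)" by simp
      also have "\<dots> \<le> (\<integral>J. e * exp (q J / w) \<partial>\<nu>)"
        using int e by (intro integral_mono) (auto split: split_indicator simp: le less_top[symmetric] intro!: integrable_real_indicator)
      also have "\<dots> = e * Z" by (simp add: Z_def)
      finally show ?thesis using Z \<beta> by (simp add: field_simps)
    qed
    have "emeasure (gibbs \<nu> w q) A \<le> (\<integral>\<^sup>+I. ennreal (e / measure \<nu> B) * indicator A I \<partial>\<nu>)"
      unfolding g using * by (intro nn_integral_mono) (auto split: split_indicator intro!: ennreal_leI)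
    also have "\<dots> = ennreal (e / measure \<nu> B * measure \<nu> A)"
      using e by (simp add: nn_integral_cmult emeasure_eq_measure flip: ennreal_mult)
    also have "\<dots> = emeasure \<nu> A / emeasure \<nu> B * ennreal e"
      using \<beta> e by (simp add: emeasure_eq_measure divide_ennreal mult.commute flip: ennreal_mult)
    finally show ?thesis .
  qed
  then show ?thesis by (simp add: A_def B_def e_def)
qed

section \<open>Asymptotics of the mixing lag\<close>

text \<open>For \<eta> > 0 the lag is long enough to push the power below
  \<open>n powr (- (p + 1))\<close>; for \<eta> = 0 the lag is 1 and the power is 0.\<close>

lemma power_mixing_lag_bigo:
  assumes "0 < p" and \<eta>: "0 \<le> \<eta>" "\<eta> < 1"
  shows "(\<lambda>n. \<eta> ^ mixing_lag p \<eta> n) \<in> O(\<lambda>n. real n powr (- p) * ln (real n))"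
proof (cases "\<eta> = 0")
  case True
  then show ?thesis by (simp add: mixing_lag_def)
next
  case False
  then have pos: "0 < \<eta>" and ln\<eta>: "ln \<eta> < 0" using \<eta> by auto
  \<comment> \<open>From 3 on, \<open>ln n\<close> is at least 1, because
    \<open>exp 1 \<le> 3\<close>.\<close>
  have "\<eta> ^ mixing_lag p \<eta> n \<le> real n powr (- p) * ln (real n)" if "3 \<le> n" for n
  proof -
    have "exp 1 \<le> real n" using exp_le that by linarith
    then have ln1: "1 \<le> ln (real n)" using that by (subst ln_ge_iff) auto
    have "(p + 1) * ln (real n) / \<bar>ln \<eta>\<bar> \<le> real (mixing_lag p \<eta> n)"
      using False real_nat_ceiling_ge by (simp add: mixing_lag_def)
    then have "ln \<eta> * real (mixing_lag p \<eta> n) \<le> - (p + 1) * ln (real n)"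
      using ln\<eta> by (simp add: field_simps)
    moreover have "\<eta> ^ mixing_lag p \<eta> n = exp (ln \<eta> * real (mixing_lag p \<eta> n))"
      using pos by (simp add: powr_realpow[symmetric] powr_def mult.commute)
    ultimately have "\<eta> ^ mixing_lag p \<eta> n \<le> real n powr (- (p + 1))"
      using that by (simp add: powr_def)
    also have "\<dots> \<le> real n powr (- p) * 1" using that by (simp add: powr_mono)
    also have "\<dots> \<le> real n powr (- p) * ln (real n)" using ln1 by (intro mult_left_mono) auto
    finally show ?thesis .
  qed
  then show ?thesis
    using \<eta>(1) by (intro bigoI[where c = 1] eventually_mono[OF eventually_ge_at_top[of 3]]) (simp add: abs_mult)
qed

text \<open>The ceiling adds at most 1, which \<open>ln n\<close> absorbs once it is at least
  1.\<close>

lemma mixing_lag_bigo: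
  assumes "0 < p" and \<eta>: "0 \<le> \<eta>" "\<eta> < 1"
  shows "(\<lambda>n. real (mixing_lag p \<eta> n)) \<in> O(\<lambda>n. ln (real n))"
proof -
  define K where "K = (if \<eta> = 0 then 0 else (p + 1) / \<bar>ln \<eta>\<bar>)"
  have "real (mixing_lag p \<eta> n) \<le> (K + 1) * ln (real n)" if "3 \<le> n" for n
  proof -
    have "exp 1 \<le> real n" using exp_le that by linarith
    then have ln1: "1 \<le> ln (real n)" using that by (subst ln_ge_iff) auto
    have "0 \<le> K" using assms(1) by (simp add: K_def)
    then have "0 \<le> K * ln (real n)" using ln1 by simp
    have "real (mixing_lag p \<eta> n) \<le> K * ln (real n) + 1"
    proof (cases "\<eta> = 0")
      case False
      then have "real (mixing_lag p \<eta> n) = real_of_int \<lceil>K * ln (real n)\<rceil>"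
        using \<open>0 \<le> K * ln (real n)\<close> by (simp add: mixing_lag_def K_def)
      then show ?thesis by linarith
    qed (simp add: mixing_lag_def K_def)
    then show ?thesis using ln1 by (simp add: algebra_simps)
  qed
  then show ?thesis
    by (intro bigoI[where c = "K + 1"] eventually_mono[OF eventually_ge_at_top[of 3]]) simp
qed

section \<open>Filtrations, total variation and outer measure\<close>

lemma sets_natural_filtration:
  "sets (natural_filtration M S Z n) =
    sigma_sets (space M) (\<Union>m\<le>n. {Z m -` B \<inter> space M |B. B \<in> sets S})"
  unfolding natural_filtration_def by (rule sets_measure_of) auto

lemma subalgebra_natural_filtration:
  assumes "\<And>m. Z m \<in> M \<rightarrow>\<^sub>M S"
  shows "subalgebra M (natural_filtration M S Z n)"
  unfolding subalgebra_def
proof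
  show "space (natural_filtration M S Z n) = space M"
    unfolding natural_filtration_def by (rule space_measure_of) auto
  show "sets (natural_filtration M S Z n) \<subseteq> sets M"
    unfolding sets_natural_filtration using assms by (intro sets.sigma_sets_subset) auto
qed

lemma vimage_in_natural_filtration:
  "m \<le> n \<Longrightarrow> B \<in> sets S \<Longrightarrow> Z m -` B \<inter> space M \<in> sets (natural_filtration M S Z n)"
  unfolding sets_natural_filtration by (intro sigma_sets.Basic) auto

text \<open>A real supremum is an upper bound only for a bounded family; for probability measures 1
  is such a bound.\<close>

lemma measure_diff_le_tv_dist:
  assumes "prob_space P" "prob_space P'" "B \<in> sets P"
  shows "\<bar>measure P B - measure P' B\<bar> \<le> tv_dist P P'"
proof -
  have "\<bar>measure P A - measure P' A\<bar> \<le> 1" for A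
    using prob_space.prob_le_1[OF assms(1), of A] prob_space.prob_le_1[OF assms(2), of A]
      measure_nonneg[of P A] measure_nonneg[of P' A] by linarith
  then show ?thesis unfolding tv_dist_def by (intro cSUP_upper assms bdd_aboveI2)
qed

text \<open>\<open>P\<close> may be nonmeasurable; \<open>B\<close> enlarged by the exceptional null
  set is a measurable cover of the same mass as \<open>B\<close>.\<close>

lemma outer_measure_of_Collect_le:
  assumes "B \<in> sets M" "AE \<omega> in M. P \<omega> \<longrightarrow> \<omega> \<in> B"
  shows "outer_measure_of M {\<omega>\<in>space M. P \<omega>} \<le> emeasure M B"
proof -
  obtain N where N: "{\<omega>\<in>space M. \<not> (P \<omega> \<longrightarrow> \<omega> \<in> B)} \<subseteq> N" "emeasure M N = 0" "N \<in> sets M"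
    using assms(2) by (rule AE_E)
  have "outer_measure_of M {\<omega>\<in>space M. P \<omega>} \<le> outer_measure_of M (B \<union> N)"
    using N(1) by (intro outer_measure_of_mono) auto
  also have "\<dots> = emeasure M B"
    using assms(1) N by (simp add: emeasure_Un_null_set null_setsI)
  finally show ?thesis .
qed

section \<open>Conditioning on an event of the past\<close>

lemma (in prob_space) integral_uniform_measure:
  fixes f :: "'a \<Rightarrow> real"
  assumes [measurable]: "f \<in> borel_measurable M" "E \<in> events" and "prob E \<noteq> 0"
  shows "(\<integral>\<omega>. f \<omega> \<partial>uniform_measure M E) = (\<integral>\<omega>\<in>E. f \<omega> \<partial>M) / prob E"
proof -
  have E: "0 < prob E" using assms(3) by (simp add: zero_less_measure_iff)
  have "uniform_measure M E = density M (\<lambda>\<omega>. ennreal (indicator E \<omega> / prob E))"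
    unfolding uniform_measure_def using E
    by (intro density_cong) (auto simp: emeasure_eq_measure divide_ennreal simp flip: ennreal_1 split: split_indicator)
  then have "(\<integral>\<omega>. f \<omega> \<partial>uniform_measure M E) = (\<integral>\<omega>. indicator E \<omega> / prob E * f \<omega> \<partial>M)"
    by (simp add: integral_density)
  then show ?thesis by (simp add: set_lebesgue_integral_def)
qed

text \<open>As \<open>E\<close> lies in \<open>F\<close>, the indicator and its conditional
  expectation have the same integral over \<open>E\<close>, and \<open>le\<close> bounds the latter
  pointwise. This transfers one transition to the law conditioned on \<open>E\<close>.\<close>

lemma (in prob_space) conditioned_step_le:
  fixes g :: "'a \<Rightarrow> real"
  assumes F: "subalgebra M F" and E: "E \<in> sets F" "prob E \<noteq> 0"
    and J[measurable]: "J \<in> M \<rightarrow>\<^sub>M N" and B[measurable]: "B \<in> sets N"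
    and g: "integrable M g"
    and le: "AE \<omega> in M. \<omega> \<in> E \<longrightarrow> real_cond_exp M F (\<lambda>\<omega>. indicator B (J \<omega>)) \<omega> \<le> g \<omega> + d"
  shows "measure (distr (uniform_measure M E) N J) B \<le> (\<integral>\<omega>. g \<omega> \<partial>uniform_measure M E) + d"
proof -
  interpret F: finite_measure_subalgebra M F by unfold_locales fact
  have [measurable]: "E \<in> events" using F E(1) by (auto simp: subalgebra_def)
  have pE: "0 < prob E" using E(2) by (simp add: zero_less_measure_iff)
  have int: "integrable M (\<lambda>\<omega>. indicator B (J \<omega>) :: real)"
    by (intro integrable_const_bound[of _ 1]) (auto split: split_indicator)
  let ?Z = "real_cond_exp M F (\<lambda>\<omega>. indicator B (J \<omega>))"
  have "prob (E \<inter> (J -` B \<inter> space M)) = (\<integral>\<omega>\<in>E. indicator B (J \<omega>) \<partial>M)"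
  proof -
    have "(\<integral>\<omega>\<in>E. indicator B (J \<omega>) \<partial>M) = (\<integral>\<omega>. indicator (E \<inter> (J -` B \<inter> space M)) \<omega> \<partial>M)"
      unfolding set_lebesgue_integral_def
      by (intro Bochner_Integration.integral_cong) (auto split: split_indicator)
    also have "\<dots> = prob (E \<inter> (J -` B \<inter> space M) \<inter> space M)"
      by (rule Bochner_Integration.integral_indicator)
    finally show ?thesis by (simp add: Int_assoc)
  qed
  also have "\<dots> = (\<integral>\<omega>\<in>E. ?Z \<omega> \<partial>M)" by (rule F.real_cond_exp_intA[OF int E(1)])
  also have "\<dots> \<le> (\<integral>\<omega>\<in>E. g \<omega> + d \<partial>M)"
    unfolding set_lebesgue_integral_def
    using le F.real_cond_exp_int(1)[OF int] g
    by (intro integral_mono_AE integrable_mult_indicator[unfolded scaleR_conv_of_real]) (auto split: split_indicator)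
  also have "\<dots> = (\<integral>\<omega>\<in>E. g \<omega> \<partial>M) + prob E * d"
  proof -
    have "integrable M (\<lambda>\<omega>. indicator E \<omega> * g \<omega>)" using integrable_mult_indicator[OF \<open>E \<in> events\<close> g] by simp
    moreover have "integrable M (\<lambda>\<omega>. d * indicator E \<omega>)"
      by (intro integrable_mult_right integrable_real_indicator) (auto simp: less_top[symmetric])
    moreover have "(\<integral>\<omega>\<in>E. g \<omega> + d \<partial>M) = (\<integral>\<omega>. indicator E \<omega> * g \<omega> + d * indicator E \<omega> \<partial>M)"
      by (simp add: set_lebesgue_integral_def algebra_simps)
    ultimately show ?thesis by (simp add: set_lebesgue_integral_def)
  qed
  finally have "prob (E \<inter> (J -` B \<inter> space M)) / prob E \<le> (\<integral>\<omega>\<in>E. g \<omega> \<partial>M) / prob E + d"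
    using pE by (simp add: field_simps)
  moreover have "measure (distr (uniform_measure M E) N J) B = prob (E \<inter> (J -` B \<inter> space M)) / prob E"
    using E(2) by (subst measure_distr) (auto simp: emeasure_eq_measure)
  ultimately show ?thesis
    using g E(2) by (subst integral_uniform_measure) auto
qed

text \<open>Since \<open>E\<close> belongs to every \<open>F j\<close>, conditioning on it keeps the
  one-step bounds, and the conditional laws of the \<open>J j\<close> form a perturbed chain for the
  single kernel \<open>R\<close>. The factor \<open>prob E\<close> makes the bound summable over
  cells and covers null events.\<close>

lemma (in prob_space) frozen_kernel_bound:
  assumes F: "\<And>j. j < k \<Longrightarrow> subalgebra M (F j)" "\<And>j. j < k \<Longrightarrow> E \<in> sets (F j)"
    and E: "E \<in> events"
    and J: "\<And>j. J j \<in> M \<rightarrow>\<^sub>M \<pi>"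
    and \<pi>: "prob_space \<pi>" and R: "R \<in> \<pi> \<rightarrow>\<^sub>M prob_algebra \<pi>" and inv: "Giry_Monad.bind \<pi> R = \<pi>"
    and mixing: "\<And>x y B. x \<in> space \<pi> \<Longrightarrow> y \<in> space \<pi> \<Longrightarrow> B \<in> sets \<pi> \<Longrightarrow>
      measure (R x) B - measure (R y) B \<le> \<eta>"
    and \<eta>: "0 \<le> \<eta>" "\<eta> < 1" and d: "0 \<le> d"
    and step: "\<And>j B. j < k \<Longrightarrow> B \<in> sets \<pi> \<Longrightarrow> AE \<omega> in M. \<omega> \<in> E \<longrightarrow>
      real_cond_exp M (F j) (\<lambda>\<omega>. indicator B (J (Suc j) \<omega>)) \<omega> \<le> measure (R (J j \<omega>)) B + d"
    and B: "B \<in> sets \<pi>"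
  shows "prob (E \<inter> (J k -` B \<inter> space M)) \<le> prob E * (measure \<pi> B + (\<eta> ^ k + d / (1 - \<eta>)))"
proof (cases "prob E = 0")
  case True
  then have "prob (E \<inter> (J k -` B \<inter> space M)) \<le> 0"
    using E by (metis finite_measure_mono Int_lower1)
  then show ?thesis using True by simp
next
  case False
  note [measurable] = J E
  have R'[measurable]: "R \<in> \<pi> \<rightarrow>\<^sub>M subprob_algebra \<pi>" using R by (rule measurable_prob_algebraD)
  let ?U = "uniform_measure M E"
  define \<mu> where "\<mu> j = distr ?U \<pi> (J j)" for j
  interpret U: prob_space ?U using False by (intro prob_space_uniform_measure) (auto simp: emeasure_eq_measure)
  have "measure (\<mu> k) B \<le> measure \<pi> B + (\<eta> ^ k + d / (1 - \<eta>))"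
  proof (rule perturbed_chain_law_bound[OF _ _ \<pi> R inv mixing \<eta> d _ B])
    show "prob_space (\<mu> j)" for j unfolding \<mu>_def by (rule U.prob_space_distr) simp
    show "sets (\<mu> j) = sets \<pi>" for j by (simp add: \<mu>_def)
    show "measure (\<mu> (Suc j)) B \<le> (\<integral>x. measure (R x) B \<partial>\<mu> j) + d" if j: "j < k" and [measurable]: "B \<in> sets \<pi>" for j B
    proof -
      have le1: "measure (R x) B \<le> 1" if "x \<in> space \<pi>" for x
        using measurable_space[OF R' that] by (auto simp: space_subprob_algebra intro: subprob_space.subprob_measure_le_1)
      have "measure (\<mu> (Suc j)) B \<le> (\<integral>\<omega>. measure (R (J j \<omega>)) B \<partial>?U) + d"
        unfolding \<mu>_def using measurable_space[OF J[of j]]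
        by (intro conditioned_step_le[OF F(1)[OF j] F(2)[OF j] False] step j)
          (auto intro!: integrable_const_bound[of _ 1] AE_I2 le1)
      also have "(\<integral>\<omega>. measure (R (J j \<omega>)) B \<partial>?U) = (\<integral>x. measure (R x) B \<partial>\<mu> j)"
        unfolding \<mu>_def by (subst integral_distr) auto
      finally show ?thesis .
    qed
  qed
  moreover have "measure (\<mu> k) B = prob (E \<inter> (J k -` B \<inter> space M)) / prob E"
    unfolding \<mu>_def using False B by (subst measure_distr) (auto simp: emeasure_eq_measure)
  moreover have "0 < prob E" using False by (simp add: zero_less_measure_iff)
  ultimately show ?thesis by (simp add: field_simps)
qed

section \<open>The probability bound along the chain and its rate\<close>

text \<open>The drift condition is guarded by \<open>L\<^sub>Q > 0\<close> because division by 0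
  yields 0, whereas the intended quotient is then infinite. The rate is guarded by
  \<open>0 < L\<^sub>P\<close> because otherwise the comparison function vanishes, while the power
  of \<eta> need not.\<close>

theorem theorem2:
  fixes b :: "real^'y" and G :: "real^'y^'m" and E :: "real^'x^'m" and U :: "real^'z^'m"
    and h :: "real^'m" and K :: "(real^'m) set"
    and Q :: "real^'x \<Rightarrow> real^'z \<Rightarrow> ereal"
    and \<X> :: "(real^'x) set" and nrm :: "real^'x \<Rightarrow> real" and BX :: "(real^'x) measure"
    and \<Xi> :: "(real^'z) set" and \<xi> :: "'i::topological_space \<Rightarrow> real^'z"
    and Qhat :: "real^'x \<Rightarrow> 'i \<Rightarrow> real"
    and \<nu> :: "'i measure" and P :: "real^'x \<Rightarrow> 'i \<Rightarrow> 'i measure"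
    and M :: "'w measure" and X :: "nat \<Rightarrow> 'w \<Rightarrow> real^'x" and I :: "nat \<Rightarrow> 'w \<Rightarrow> 'i"
    and \<alpha> :: "nat \<Rightarrow> real"
    and \<epsilon> w L\<^sub>Q L\<^sub>P \<eta> p \<Delta> c C\<^sub>\<alpha> :: real
  assumes cone: "convex_cone K"
    and Q: "Q = recourse_value b G E U h K"
    and norm: "is_norm nrm"
    and BX: "space BX = \<X>" "sets (restrict_space borel \<X>) \<subseteq> sets BX"
    and \<xi>_meas: "\<xi> \<in> borel \<rightarrow>\<^sub>M restrict_space borel \<Xi>"
    and \<xi>_sup: "\<And>x. x \<in> \<X> \<Longrightarrow> (SUP I. Q x (\<xi> I)) = (SUP z\<in>\<Xi>. Q x z)"
    and Qhat_meas: "\<And>x. x \<in> \<X> \<Longrightarrow> Qhat x \<in> borel_measurable borel"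
    and \<epsilon>: "0 \<le> \<epsilon>"
    and Qhat_error: "\<And>x I. x \<in> \<X> \<Longrightarrow> \<bar>Q x (\<xi> I) - ereal (Qhat x I)\<bar> \<le> ereal \<epsilon>"
    and \<nu>: "sets \<nu> = sets borel" "finite_measure \<nu>" "full_support \<nu>"
    and w: "0 < w"
    and gibbs_well_defined: "\<And>x. x \<in> \<X> \<Longrightarrow> integrable \<nu> (\<lambda>I. exp (Qhat x I / w))"
    and kernel: "\<And>x. x \<in> \<X> \<Longrightarrow> P x \<in> borel \<rightarrow>\<^sub>M prob_algebra borel"
    and invariant: "\<And>x. x \<in> \<X> \<Longrightarrow>
      Giry_Monad.bind (gibbs \<nu> w (Qhat x)) (P x) = gibbs \<nu> w (Qhat x)"
    and L\<^sub>Q: "0 \<le> L\<^sub>Q"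
    and lipschitz_score: "\<And>x x' i. x \<in> \<X> \<Longrightarrow> x' \<in> \<X> \<Longrightarrow>
      \<bar>Qhat x i - Qhat x' i\<bar> \<le> L\<^sub>Q * nrm (x - x')"
    and L\<^sub>P: "0 \<le> L\<^sub>P"
    and lipschitz_kernel: "\<And>x y i. x \<in> \<X> \<Longrightarrow> y \<in> \<X> \<Longrightarrow>
      tv_dist (P x i) (P y i) \<le> L\<^sub>P * nrm (x - y)"
    and \<eta>: "0 \<le> \<eta>" "\<eta> < 1"
    and uniform_mixing: "\<And>x i j. x \<in> \<X> \<Longrightarrow> tv_dist (P x i) (P x j) \<le> \<eta>"
    and M: "prob_space M"
    and X_rv: "\<And>n. X n \<in> M \<rightarrow>\<^sub>M BX"
    and I_rv: "\<And>n. I n \<in> M \<rightarrow>\<^sub>M borel"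
    and transition: "\<And>n B. B \<in> sets borel \<Longrightarrow>
      AE \<omega> in M.
        real_cond_exp M
          (natural_filtration M (borel \<Otimes>\<^sub>M BX) (\<lambda>m \<omega>. (I m \<omega>, X m \<omega>)) n)
          (\<lambda>\<omega>. indicator B (I (Suc n) \<omega>)) \<omega>
        = measure (P (X n \<omega>) (I n \<omega>)) B"
    and p: "0 < p"
    and \<Delta>: "2 * \<epsilon> < \<Delta>"
    and c: "0 \<le> c"
    and steps: "\<And>n. 1 \<le> n \<Longrightarrow> AE \<omega> in M. nrm (X n \<omega> - X (n - 1) \<omega>) \<le> c * \<alpha> n"
    and C\<^sub>\<alpha>: "0 < C\<^sub>\<alpha>"
    and step_size: "\<And>n. 1 \<le> n \<Longrightarrow> \<alpha> n \<le> C\<^sub>\<alpha> * real n powr (- p)"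
  shows "(\<forall>n. real (mixing_lag p \<eta> n) < real n / 2 \<longrightarrow>
      (L\<^sub>Q > 0 \<longrightarrow> 2 powr p * c * C\<^sub>\<alpha> * real (mixing_lag p \<eta> n) * real n powr (- p)
                \<le> (\<Delta> - 2 * \<epsilon>) / (4 * L\<^sub>Q)) \<longrightarrow>
      outer_measure_of M {\<omega> \<in> space M. I n \<omega> \<notin> near_max (\<lambda>J. Q (X (n - 1) \<omega>) (\<xi> J)) \<Delta>}
      \<le> ennreal (\<eta> ^ mixing_lag p \<eta> n
            + 2 powr p * c * L\<^sub>P * C\<^sub>\<alpha> / (1 - \<eta>) * real (mixing_lag p \<eta> n) * real n powr (- p))
        + (SUP x\<in>\<X>. emeasure \<nu> (- near_max (\<lambda>J. ereal (Qhat x J)) ((\<Delta> - 2 * \<epsilon>) / 2))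
                    / emeasure \<nu> (near_max (\<lambda>J. ereal (Qhat x J)) ((\<Delta> - 2 * \<epsilon>) / 4)))
          * ennreal (exp (- ((\<Delta> - 2 * \<epsilon>) / (4 * w)))))
    \<and> (0 < L\<^sub>P \<longrightarrow>
      (\<lambda>n. \<eta> ^ mixing_lag p \<eta> n
          + 2 powr p * c * L\<^sub>P * C\<^sub>\<alpha> / (1 - \<eta>) * real (mixing_lag p \<eta> n) * real n powr (- p))
      \<in> O(\<lambda>n. L\<^sub>P / (1 - \<eta>) * (real n powr (- p) * ln (real n))))"
proof (intro conjI allI impI)
  fix n
  assume lag_lt: "real (mixing_lag p \<eta> n) < real n / 2"
    and drift: "L\<^sub>Q > 0 \<longrightarrow> 2 powr p * c * C\<^sub>\<alpha> * real (mixing_lag p \<eta> n) * real n powr (- p)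
      \<le> (\<Delta> - 2 * \<epsilon>) / (4 * L\<^sub>Q)"
  interpret prob_space M by (rule M)
  define k where "k = mixing_lag p \<eta> n"
  define m where "m = n - k"
  define \<delta> where "\<delta> = \<Delta> - 2 * \<epsilon>"
  \<comment> \<open>\<open>t\<close> bounds one increment with index at least \<open>n / 2\<close>,
    and \<open>r\<close> bounds the \<open>k - 1\<close> increments from \<open>X m\<close> to
    \<open>X (n - 1)\<close>. The subtraction is real, so \<open>r\<close> is a sensible bound only
    for \<open>k \<ge> 1\<close>.\<close>
  define t where "t = 2 powr p * c * C\<^sub>\<alpha> * real n powr (- p)"
  define r where "r = (real k - 1) * t"
  define a where "a = \<eta> ^ k + 2 powr p * c * L\<^sub>P * C\<^sub>\<alpha> / (1 - \<eta>) * real k * real n powr (- p)"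
  define gap where "gap = (SUP x\<in>\<X>. emeasure \<nu> (- near_max (\<lambda>J. ereal (Qhat x J)) (\<delta> / 2))
                    / emeasure \<nu> (near_max (\<lambda>J. ereal (Qhat x J)) (\<delta> / 4)))
          * ennreal (exp (- (\<delta> / (4 * w))))"
  define bad where "bad \<omega> \<longleftrightarrow> I n \<omega> \<notin> near_max (\<lambda>J. Q (X (n - 1) \<omega>) (\<xi> J)) \<Delta>" for \<omega>
  have \<delta>: "0 < \<delta>" using \<Delta> by (simp add: \<delta>_def)
  have t: "0 \<le> t" using c C\<^sub>\<alpha> by (simp add: t_def)
  have a: "0 \<le> a" using \<eta> c L\<^sub>P C\<^sub>\<alpha> by (auto simp: a_def intro!: add_nonneg_nonneg mult_nonneg_nonneg divide_nonneg_pos)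
  have "outer_measure_of M {\<omega>\<in>space M. bad \<omega>} \<le> ennreal a + gap"
  proof (cases "k = 0")
    \<comment> \<open>This is \<open>n = 1\<close>, where the logarithm vanishes;
      \<open>\<eta> ^ 0 = 1\<close> makes the bound trivial.\<close>
    case True
    have "outer_measure_of M {\<omega>\<in>space M. bad \<omega>} \<le> outer_measure_of M (space M)"
      by (intro outer_measure_of_mono) auto
    also have "\<dots> = ennreal a" using True by (simp add: a_def emeasure_space_1)
    also have "\<dots> \<le> ennreal a + gap" by simp
    finally show ?thesis .
  next
    case False
    have kn: "2 * k < n" using lag_lt by (simp add: k_def)
    \<comment> \<open>The strictness comes from \<open>k - 1 < k\<close> and leaves room for the
      cell size.\<close>
    have "L\<^sub>Q * r < \<delta> / 4"
    proof (cases "0 < L\<^sub>Q \<and> 0 < t")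
      case True
      then have "L\<^sub>Q * (t * real k) \<le> \<delta> / 4"
        using drift by (simp add: k_def t_def \<delta>_def field_simps)
      moreover have "L\<^sub>Q * r < L\<^sub>Q * (t * real k)" using True by (simp add: r_def algebra_simps)
      ultimately show ?thesis by linarith
    next
      case False
      then show ?thesis using t L\<^sub>Q \<delta> by (auto simp: r_def)
    qed
    have X_in: "X j \<omega> \<in> \<X>" if "\<omega> \<in> space M" for j \<omega>
      using measurable_space[OF X_rv that] BX(1) by simp
    have nrm_tri: "nrm (x + y) \<le> nrm x + nrm y" for x y using norm by (simp add: is_norm_def)
    have "AE \<omega> in M. \<forall>i\<in>{1..}. nrm (X i \<omega> - X (i - 1) \<omega>) \<le> c * \<alpha> i"
      using steps by (intro AE_ball_countable[THEN iffD2]) auto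
    then have incr: "AE \<omega> in M. \<forall>j<k. nrm (X (m + j) \<omega> - X m \<omega>) \<le> r"
    proof eventually_elim
      case (elim \<omega>)
      have "nrm (X (m + j) \<omega> - X m \<omega>) \<le> real j * t" for j
      proof (induction j)
        case 0
        have "nrm 0 = 0" using norm unfolding is_norm_def by blast
        then show ?case by simp
      next
        case (Suc j)
        let ?i = "m + Suc j"
        \<comment> \<open>The index stays above \<open>n / 2\<close> since \<open>2 * k < n\<close>;
          this is the origin of the factor \<open>2 powr p\<close>.\<close>
        have "real n / 2 \<le> real ?i" using kn by (simp add: m_def)
        then have "real ?i powr (- p) \<le> (real n / 2) powr (- p)"
          using p kn by (intro powr_mono2') auto
        also have "\<dots> = 2 powr p * real n powr (- p)"
          by (simp add: powr_divide powr_minus divide_simps)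
        finally have "c * (C\<^sub>\<alpha> * real ?i powr (- p)) \<le> t"
          using c C\<^sub>\<alpha> by (simp add: t_def mult_left_mono mult.assoc mult.left_commute[of "2 powr p"])
        moreover have "c * \<alpha> ?i \<le> c * (C\<^sub>\<alpha> * real ?i powr (- p))"
          using step_size[of ?i] c by (intro mult_left_mono) auto
        moreover have "nrm (X ?i \<omega> - X (m + j) \<omega>) \<le> c * \<alpha> ?i"
          using elim[THEN bspec, of ?i] by simp
        moreover have "nrm (X ?i \<omega> - X m \<omega>) \<le> nrm (X ?i \<omega> - X (m + j) \<omega>) + nrm (X (m + j) \<omega> - X m \<omega>)"
          using nrm_tri[of "X ?i \<omega> - X (m + j) \<omega>" "X (m + j) \<omega> - X m \<omega>"] by simp
        ultimately show ?case using Suc by (simp add: algebra_simps)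
      qed
      moreover have "real j * t \<le> r" if "j < k" for j
        unfolding r_def using t that by (intro mult_right_mono) auto
      ultimately show ?case by (meson order_trans)
    qed
    show ?thesis
    proof (rule ennreal_le_epsilon)
      fix e0 :: real assume "0 < e0"
      \<comment> \<open>The first bound fits \<rho> into the room left in the score comparison, the
        second keeps its kernel cost below \<open>e0\<close>. Adding 1 in the denominators avoids
        division by 0.\<close>
      define \<rho> where "\<rho> = min ((\<delta> / 4 - L\<^sub>Q * r) / (L\<^sub>Q + 1)) (e0 * (1 - \<eta>) / (L\<^sub>P + 1))"
      have \<rho>: "0 < \<rho>" using \<open>L\<^sub>Q * r < \<delta> / 4\<close> \<open>0 < e0\<close> L\<^sub>Q L\<^sub>P \<eta> by (simp add: \<rho>_def)
      have "\<rho> \<le> (\<delta> / 4 - L\<^sub>Q * r) / (L\<^sub>Q + 1)" unfolding \<rho>_def by (rule min.cobounded1)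
      then have "(L\<^sub>Q + 1) * \<rho> \<le> \<delta> / 4 - L\<^sub>Q * r"
        using L\<^sub>Q by (simp flip: pos_le_divide_eq add: mult.commute[of _ \<rho>])
      then have \<rho>Q: "L\<^sub>Q * (r + \<rho>) \<le> \<delta> / 4" using \<rho> by (simp add: algebra_simps)
      have "\<rho> \<le> e0 * (1 - \<eta>) / (L\<^sub>P + 1)" unfolding \<rho>_def by (rule min.cobounded2)
      then have "(L\<^sub>P + 1) * \<rho> \<le> e0 * (1 - \<eta>)"
        using L\<^sub>P by (simp flip: pos_le_divide_eq add: mult.commute[of _ \<rho>])
      then have \<rho>P: "L\<^sub>P * \<rho> / (1 - \<eta>) \<le> e0" using \<rho> \<eta> by (simp add: algebra_simps pos_divide_le_eq)
      define d where "d = L\<^sub>P * (r + \<rho>)"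
      have r: "0 \<le> r" using False t by (simp add: r_def)
      have d: "0 \<le> d" using r \<rho> L\<^sub>P by (simp add: d_def)
      have ne: "\<X> \<noteq> {}" using X_in not_empty by blast
      obtain C :: "nat \<Rightarrow> (real^'x) set" and y where C: "disjoint_family C" "(\<Union>j. C j) = \<X>" "\<And>j. C j \<in> sets (restrict_space borel \<X>)"
        and y: "\<And>j. y j \<in> \<X>" "\<And>j x. x \<in> C j \<Longrightarrow> nrm (x - y j) \<le> \<rho>"
        using countable_partition_small_cells[OF norm ne \<rho>] by metis
      define E where "E j = X m -` C j \<inter> space M" for j
      \<comment> \<open>The score at the fixed \<open>y j\<close> replaces the recourse value at the
        random incumbent, so \<open>A j\<close> is a Borel set.\<close>
      define A where "A j = - near_max (\<lambda>J. ereal (Qhat (y j) J)) (\<delta> / 2)" for j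
      have C_sets: "C j \<in> sets BX" for j using C(3) BX(2) by blast
      have [measurable]: "E j \<in> events" for j unfolding E_def using X_rv C_sets by (rule measurable_sets)
      have "near_max (\<lambda>J. ereal (Qhat (y j) J)) (\<delta> / 2) \<in> sets borel" for j
        using Qhat_meas[OF y(1)] by (intro sets_near_max) auto
      then have A_sets[measurable]: "A j \<in> sets borel" for j unfolding A_def by (intro borel_comp)
      note [measurable] = I_rv
      define V where "V = ennreal (\<eta> ^ k + d / (1 - \<eta>)) + gap"

      \<comment> \<open>Budget of tolerances: \<open>\<delta> / 2\<close> at \<open>y j\<close>,
        then \<open>2 * (\<delta> / 4)\<close> for moving to \<open>X (n - 1)\<close>, then
        \<open>2 * \<epsilon>\<close> for passing from the score to \<open>Q\<close>, which totals
        \<Delta>.\<close>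
      have "AE \<omega> in M. bad \<omega> \<longrightarrow> \<omega> \<in> (\<Union>j. E j \<inter> (I n -` A j \<inter> space M))"
        using incr AE_space
      proof eventually_elim
        case (elim \<omega>)
        show ?case
        proof
          assume "bad \<omega>"
          have "X m \<omega> \<in> (\<Union>j. C j)" using X_in[OF elim(2)] C(2) by simp
          then obtain j where j: "X m \<omega> \<in> C j" by blast
          let ?x = "X (n - 1) \<omega>"
          have x: "?x \<in> \<X>" using X_in[OF elim(2)] .
          have "m + (k - 1) = n - 1" using False kn by (simp add: m_def)
          then have "nrm (?x - X m \<omega>) \<le> r" using elim(1)[rule_format, of "k - 1"] False by simp
          then have "nrm (?x - y j) \<le> r + \<rho>"
            using nrm_tri[of "?x - X m \<omega>" "X m \<omega> - y j"] y(2)[OF j] by simp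
          then have "L\<^sub>Q * nrm (?x - y j) \<le> \<delta> / 4" using \<rho>Q L\<^sub>Q by (meson mult_left_mono order_trans)
          then have "\<bar>ereal (Qhat ?x i) - ereal (Qhat (y j) i)\<bar> \<le> ereal (\<delta> / 4)" for i
            using lipschitz_score[OF x y(1)[of j], of i] by simp
          then have "near_max (\<lambda>i. ereal (Qhat (y j) i)) (\<delta> / 2)
              \<subseteq> near_max (\<lambda>i. ereal (Qhat ?x i)) (\<delta> / 2 + 2 * (\<delta> / 4))" by (rule near_max_perturb)
          also have "\<delta> / 2 + 2 * (\<delta> / 4) = \<delta>" by simp
          also have "near_max (\<lambda>i. ereal (Qhat ?x i)) \<delta> \<subseteq> near_max (\<lambda>J. Q ?x (\<xi> J)) (\<delta> + 2 * \<epsilon>)"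
            using Qhat_error[OF x] by (rule near_max_perturb)
          also have "\<delta> + 2 * \<epsilon> = \<Delta>" by (simp add: \<delta>_def)
          finally have "I n \<omega> \<in> A j" using \<open>bad \<omega>\<close> by (auto simp: A_def bad_def)
          then show "\<omega> \<in> (\<Union>j. E j \<inter> (I n -` A j \<inter> space M))" using j elim(2) by (auto simp: E_def)
        qed
      qed
      then have "outer_measure_of M {\<omega>\<in>space M. bad \<omega>} \<le> emeasure M (\<Union>j. E j \<inter> (I n -` A j \<inter> space M))"
        by (intro outer_measure_of_Collect_le) measurable
      also have "\<dots> \<le> (\<Sum>j. emeasure M (E j \<inter> (I n -` A j \<inter> space M)))"
        by (intro emeasure_subadditive_countably) auto
      \<comment> \<open>Each cell pays in proportion to its probability. As the \<open>E j\<close>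
        are disjoint, countably many cells together cost no more than one \<open>V\<close>.\<close>
      also have "\<dots> \<le> (\<Sum>j. emeasure M (E j) * V)"
      proof (intro suminf_le summableI)
        fix j
        let ?\<pi> = "gibbs \<nu> w (Qhat (y j))"
        have \<nu>_ne: "emeasure \<nu> UNIV \<noteq> 0" using \<nu>(3) by (auto simp: full_support_def)
        have sp: "space \<nu> = UNIV" using \<nu>(1) by (metis sets_eq_imp_space_eq space_borel)
        have sets\<pi>: "sets ?\<pi> = sets borel" by (simp add: gibbs_def \<nu>(1))
        then have sp\<pi>: "space ?\<pi> = UNIV" by (metis sets_eq_imp_space_eq space_borel)
        interpret \<pi>: prob_space ?\<pi>
          using gibbs_well_defined[OF y(1)] \<nu>_ne sp by (intro prob_space_gibbs) auto
        let ?F = "\<lambda>i. natural_filtration M (borel \<Otimes>\<^sub>M BX) (\<lambda>m \<omega>. (I m \<omega>, X m \<omega>)) (m + i)"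
        have P_prob: "prob_space (P x i)" "sets (P x i) = sets borel" if "x \<in> \<X>" for x i
          using measurable_space[OF kernel[OF that], of i] by (auto simp: space_prob_algebra)
        have "prob (E j \<inter> (I (m + k) -` A j \<inter> space M))
            \<le> prob (E j) * (measure ?\<pi> (A j) + (\<eta> ^ k + d / (1 - \<eta>)))"
        proof (rule frozen_kernel_bound[where F = ?F and R = "P (y j)" and J = "\<lambda>i. I (m + i)"])
          show "subalgebra M (?F i)" for i
            using I_rv X_rv by (intro subalgebra_natural_filtration) measurable
          \<comment> \<open>The cell is determined by \<open>X m\<close>, hence known at time
            \<open>m\<close> and at all later times.\<close>
          have "E j = (\<lambda>\<omega>. (I m \<omega>, X m \<omega>)) -` (UNIV \<times> C j) \<inter> space M" by (auto simp: E_def)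
          also have "\<dots> \<in> sets (?F i)" for i
            using C_sets[of j] by (intro vimage_in_natural_filtration[where Z = "\<lambda>m \<omega>. (I m \<omega>, X m \<omega>)"]) auto
          finally show "E j \<in> sets (?F i)" for i .
          show "E j \<in> events" by simp
          show "I (m + i) \<in> M \<rightarrow>\<^sub>M ?\<pi>" for i using I_rv measurable_cong_sets[OF refl sets\<pi>] by blast
          show "prob_space ?\<pi>" by unfold_locales
          \<comment> \<open>\<open>prob_algebra\<close> depends on its argument only through the
            \<sigma>-algebra, which here is the Borel one.\<close>
          show "P (y j) \<in> ?\<pi> \<rightarrow>\<^sub>M prob_algebra ?\<pi>"
            using kernel[OF y(1)[of j]]
            unfolding prob_algebra_def subprob_algebra_cong[OF sets\<pi>] measurable_cong_sets[OF sets\<pi> refl] .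
          show "Giry_Monad.bind ?\<pi> (P (y j)) = ?\<pi>" using invariant[OF y(1)] .
          show "measure (P (y j) u) B - measure (P (y j) v) B \<le> \<eta>" if "B \<in> sets ?\<pi>" for u v B
            using measure_diff_le_tv_dist[of "P (y j) u" "P (y j) v" B] uniform_mixing[OF y(1), of j u v]
              P_prob[OF y(1)] that sets\<pi> by auto
          show "0 \<le> \<eta>" "\<eta> < 1" "0 \<le> d" by fact+
          show "A j \<in> sets ?\<pi>" by (simp add: sets\<pi> A_sets)
          fix i B assume i: "i < k" and B: "B \<in> sets ?\<pi>"
          have "AE \<omega> in M. real_cond_exp M (?F i) (\<lambda>\<omega>. indicator B (I (Suc (m + i)) \<omega>)) \<omega>
              = measure (P (X (m + i) \<omega>) (I (m + i) \<omega>)) B"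
            using B sets\<pi> by (intro transition) auto
          \<comment> \<open>On the cell the incumbent is within \<open>r + \<rho>\<close> of
            \<open>y j\<close> throughout the window, so the Lipschitz bound for the kernels costs
            at most \<open>d\<close> per step.\<close>
          with incr AE_space show "AE \<omega> in M. \<omega> \<in> E j \<longrightarrow>
              real_cond_exp M (?F i) (\<lambda>\<omega>. indicator B (I (m + Suc i) \<omega>)) \<omega>
              \<le> measure (P (y j) (I (m + i) \<omega>)) B + d"
          proof eventually_elim
            case (elim \<omega>)
            show ?case
            proof
              assume "\<omega> \<in> E j"
              then have "X m \<omega> \<in> C j" by (simp add: E_def)
              let ?x = "X (m + i) \<omega>"
              have x: "?x \<in> \<X>" using X_in[OF elim(2)] .
              have "nrm (?x - y j) \<le> r + \<rho>"
                using nrm_tri[of "?x - X m \<omega>" "X m \<omega> - y j"] y(2)[OF \<open>X m \<omega> \<in> C j\<close>]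
                  elim(1)[rule_format, OF i] by simp
              then have "L\<^sub>P * nrm (?x - y j) \<le> d" unfolding d_def using L\<^sub>P by (intro mult_left_mono)
              then have "measure (P ?x (I (m + i) \<omega>)) B \<le> measure (P (y j) (I (m + i) \<omega>)) B + d"
                using measure_diff_le_tv_dist[of "P ?x (I (m + i) \<omega>)" "P (y j) (I (m + i) \<omega>)" B]
                  lipschitz_kernel[OF x y(1)[of j], of "I (m + i) \<omega>"] P_prob[OF y(1)[of j]] P_prob[OF x] B sets\<pi>
                by (auto simp: abs_le_iff)
              then show "real_cond_exp M (?F i) (\<lambda>\<omega>. indicator B (I (m + Suc i) \<omega>)) \<omega>
                  \<le> measure (P (y j) (I (m + i) \<omega>)) B + d"
                using elim(3) by simp
            qed
          qed
        qed
        moreover have "m + k = n" using kn by (simp add: m_def)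
        ultimately have "emeasure M (E j \<inter> (I n -` A j \<inter> space M))
            \<le> ennreal (prob (E j) * (measure ?\<pi> (A j) + (\<eta> ^ k + d / (1 - \<eta>))))"
          by (simp only: emeasure_eq_measure ennreal_leI)
        also have "\<dots> = emeasure M (E j) * (ennreal (\<eta> ^ k + d / (1 - \<eta>)) + emeasure ?\<pi> (A j))"
        proof -
          have "ennreal (prob (E j) * (measure ?\<pi> (A j) + s)) = ennreal (prob (E j)) * (ennreal s + ennreal (measure ?\<pi> (A j)))"
            if "0 \<le> s" for s using that by (simp add: ennreal_mult add.commute)
          then show ?thesis using d \<eta> by (simp only: emeasure_eq_measure \<pi>.emeasure_eq_measure) simp
        qed
        also have "emeasure ?\<pi> (A j) \<le> gap"
        proof -
          have "Qhat (y j) \<in> borel_measurable \<nu>"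
            using Qhat_meas[OF y(1)] measurable_cong_sets[OF \<nu>(1) refl] by blast
          from gibbs_compl_near_max_le[OF this \<nu>(2) sp gibbs_well_defined[OF y(1)] \<nu>_ne w, of \<delta>]
          show ?thesis unfolding A_def gap_def
            by (rule order_trans) (intro mult_right_mono SUP_upper y zero_le)
        qed
        finally show "emeasure M (E j \<inter> (I n -` A j \<inter> space M)) \<le> emeasure M (E j) * V"
          by (simp add: V_def mult_left_mono)
      qed
      also have "\<dots> = (\<Sum>j. emeasure M (E j)) * V" by simp
      also have "(\<Sum>j. emeasure M (E j)) = emeasure M (\<Union>j. E j)"
      proof (rule suminf_emeasure)
        show "disjoint_family E" using C(1) by (auto simp: disjoint_family_on_def E_def)
      qed auto
      also have "\<dots> * V \<le> 1 * V"
        by (intro mult_right_mono) (auto simp: emeasure_eq_measure intro!: ennreal_le_1[THEN iffD2])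
      also have "1 * V \<le> ennreal (a + e0) + gap"
      proof -
        \<comment> \<open>Here \<open>k - 1\<close> is rounded up to \<open>k\<close>, as in the
          stated bound; the part due to \<rho> becomes \<open>e0\<close>.\<close>
        have "d \<le> L\<^sub>P * (real k * t) + L\<^sub>P * \<rho>"
          using t L\<^sub>P by (simp add: d_def r_def algebra_simps)
        then have "d / (1 - \<eta>) \<le> L\<^sub>P * (real k * t) / (1 - \<eta>) + L\<^sub>P * \<rho> / (1 - \<eta>)"
          using \<eta> by (simp add: divide_right_mono flip: add_divide_distrib)
        moreover have "L\<^sub>P * (real k * t) / (1 - \<eta>) = 2 powr p * c * L\<^sub>P * C\<^sub>\<alpha> / (1 - \<eta>) * real k * real n powr (- p)"
          by (simp add: t_def mult_ac)
        ultimately have "\<eta> ^ k + d / (1 - \<eta>) \<le> a + e0" using \<rho>P by (simp add: a_def)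
        then show ?thesis unfolding V_def by (simp add: add_right_mono ennreal_leI)
      qed
      also have "\<dots> = ennreal a + gap + ennreal e0"
        using a \<open>0 < e0\<close> by (simp add: ac_simps)
      finally show "outer_measure_of M {\<omega>\<in>space M. bad \<omega>} \<le> ennreal a + gap + ennreal e0" .
    qed
  qed
  then show "outer_measure_of M {\<omega> \<in> space M. I n \<omega> \<notin> near_max (\<lambda>J. Q (X (n - 1) \<omega>) (\<xi> J)) \<Delta>}
      \<le> ennreal (\<eta> ^ mixing_lag p \<eta> n
            + 2 powr p * c * L\<^sub>P * C\<^sub>\<alpha> / (1 - \<eta>) * real (mixing_lag p \<eta> n) * real n powr (- p))
        + (SUP x\<in>\<X>. emeasure \<nu> (- near_max (\<lambda>J. ereal (Qhat x J)) ((\<Delta> - 2 * \<epsilon>) / 2))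
                    / emeasure \<nu> (near_max (\<lambda>J. ereal (Qhat x J)) ((\<Delta> - 2 * \<epsilon>) / 4)))
          * ennreal (exp (- ((\<Delta> - 2 * \<epsilon>) / (4 * w))))"
    unfolding bad_def a_def gap_def k_def \<delta>_def .
next
  assume "0 < L\<^sub>P"
  then have K: "L\<^sub>P / (1 - \<eta>) \<noteq> 0" using \<eta> by simp
  have "(\<lambda>n. real (mixing_lag p \<eta> n) * real n powr (- p)) \<in> O(\<lambda>n. ln (real n) * real n powr (- p))"
    by (intro landau_o.big.mult mixing_lag_bigo p \<eta> landau_o.big_refl)
  then have "(\<lambda>n. 2 powr p * c * L\<^sub>P * C\<^sub>\<alpha> / (1 - \<eta>) * (real (mixing_lag p \<eta> n) * real n powr (- p)))
      \<in> O(\<lambda>n. real n powr (- p) * ln (real n))"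
    using landau_o.big.mult[OF bigo_const[of "2 powr p * c * L\<^sub>P * C\<^sub>\<alpha> / (1 - \<eta>)"]]
    by (simp only: mult_1 mult.commute[of "ln (real _)"]) fastforce
  then have "(\<lambda>n. \<eta> ^ mixing_lag p \<eta> n
      + 2 powr p * c * L\<^sub>P * C\<^sub>\<alpha> / (1 - \<eta>) * real (mixing_lag p \<eta> n) * real n powr (- p))
      \<in> O(\<lambda>n. real n powr (- p) * ln (real n))"
    by (intro sum_in_bigo power_mixing_lag_bigo p \<eta>) (simp add: mult.assoc)
  then show "(\<lambda>n. \<eta> ^ mixing_lag p \<eta> n
      + 2 powr p * c * L\<^sub>P * C\<^sub>\<alpha> / (1 - \<eta>) * real (mixing_lag p \<eta> n) * real n powr (- p))
      \<in> O(\<lambda>n. L\<^sub>P / (1 - \<eta>) * (real n powr (- p) * ln (real n)))"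
    using K by (subst landau_o.big.cmult)
qed

end
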